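(* Let $A$ be a commutative unital ring, $M$ an $A$-module and $N\subseteq M$ a submodule. The following statements are equivalent: (a) $N\subseteq M$ is a complemented distributive submodule. (b) There exists a central idempotent endomorphism $e\in\operatorname{End}_A(M)$ such that $e(M)=N$ and $e$ belongs to the closure of $A/\operatorname{Ann}(M)\subseteq\operatorname{End}_A(M)$ in the finite topology.
   Context: A submodule $N\subseteq M$ is distributive if $(Y_1+Y_2)\cap N=(Y_1\cap N)+(Y_2\cap N)$ for all submodules $Y_1,Y_2\subseteq M$. A complemented distributive submodule of $M$ is a distributive submodule that is also a direct summand of $M$. The ring $A/\operatorname{Ann}(M)$ is regarded as a subring of $\operatorname{End}_A(M)$, each class $\overline{a}$ acting as multiplication by $a$. The finite topology on $\operatorname{End}_A(M)$ is the topology in which a subbase of neighbourhoods of $f\in\operatorname{End}_A(M)$ is given by the sets $B(\{m_1,\ldots,m_t\},f)=\{g\in\operatorname{End}_A(M)\mid g(m_i)=f(m_i),\ i=1,\ldots,t\}$, for finite subsets $\{m_1,\ldots,m_t\}\subseteq M$. *)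

theory Defs
  imports "HOL-Algebra.QuotRing" "HOL-Algebra.Module" "HOL-Analysis.Abstract_Topology"
begin

definition distributive_submodule ::
    "('a, 'r) ring_scheme \<Rightarrow> ('a, 'b, 'm) module_scheme \<Rightarrow> 'b set \<Rightarrow> bool" where
  "distributive_submodule R M N \<longleftrightarrow> submodule N R M \<and>
     (\<forall>Y1 Y2. submodule Y1 R M \<longrightarrow> submodule Y2 R M \<longrightarrow>
        (Y1 <+>\<^bsub>M\<^esub> Y2) \<inter> N = (Y1 \<inter> N) <+>\<^bsub>M\<^esub> (Y2 \<inter> N))"

definition direct_summand ::
    "('a, 'r) ring_scheme \<Rightarrow> ('a, 'b, 'm) module_scheme \<Rightarrow> 'b set \<Rightarrow> bool" where
  "direct_summand R M N \<longleftrightarrow> submodule N R M \<and>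
     (\<exists>N'. submodule N' R M \<and> N \<inter> N' = {\<zero>\<^bsub>M\<^esub>} \<and> N <+>\<^bsub>M\<^esub> N' = carrier M)"

definition complemented_distributive_submodule ::
    "('a, 'r) ring_scheme \<Rightarrow> ('a, 'b, 'm) module_scheme \<Rightarrow> 'b set \<Rightarrow> bool" where
  "complemented_distributive_submodule R M N \<longleftrightarrow>
     distributive_submodule R M N \<and> direct_summand R M N"

text \<open>Endomorphisms are represented by functions that are \<^const>\<open>undefined\<close> outside
  the carrier, so that equality of endomorphisms is equality in HOL.\<close>

definition module_End :: "('a, 'r) ring_scheme \<Rightarrow> ('a, 'b, 'm) module_scheme \<Rightarrow> ('b \<Rightarrow> 'b) ring" where
  "module_End R M =
    \<lparr>carrier = {f \<in> carrier M \<rightarrow>\<^sub>E carrier M.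
        (\<forall>x\<in>carrier M. \<forall>y\<in>carrier M. f (x \<oplus>\<^bsub>M\<^esub> y) = f x \<oplus>\<^bsub>M\<^esub> f y) \<and>
        (\<forall>a\<in>carrier R. \<forall>x\<in>carrier M. f (a \<odot>\<^bsub>M\<^esub> x) = a \<odot>\<^bsub>M\<^esub> f x)},
     mult = compose (carrier M),
     one = (\<lambda>x\<in>carrier M. x),
     zero = (\<lambda>x\<in>carrier M. \<zero>\<^bsub>M\<^esub>),
     add = (\<lambda>f g. \<lambda>x\<in>carrier M. f x \<oplus>\<^bsub>M\<^esub> g x)\<rparr>"

definition central_idempotent :: "('a, 'r) ring_scheme \<Rightarrow> 'a \<Rightarrow> bool" where
  "central_idempotent E e \<longleftrightarrow> e \<in> carrier E \<and> e \<otimes>\<^bsub>E\<^esub> e = e \<and>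
     (\<forall>f\<in>carrier E. e \<otimes>\<^bsub>E\<^esub> f = f \<otimes>\<^bsub>E\<^esub> e)"

definition module_Ann :: "('a, 'r) ring_scheme \<Rightarrow> ('a, 'b, 'm) module_scheme \<Rightarrow> 'a set" where
  "module_Ann R M = {a \<in> carrier R. \<forall>x\<in>carrier M. a \<odot>\<^bsub>M\<^esub> x = \<zero>\<^bsub>M\<^esub>}"

definition scalar_End :: "('a, 'b, 'm) module_scheme \<Rightarrow> 'a \<Rightarrow> 'b \<Rightarrow> 'b" where
  "scalar_End M a = (\<lambda>x\<in>carrier M. a \<odot>\<^bsub>M\<^esub> x)"

text \<open>An element of the quotient ring \<open>R Quot module_Ann R M\<close> is a coset, all of whose members
  act on \<open>M\<close> by the same endomorphism.\<close>

definition quot_Ann_embedding :: "('a, 'b, 'm) module_scheme \<Rightarrow> 'a set \<Rightarrow> 'b \<Rightarrow> 'b" where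
  "quot_Ann_embedding M X = the_elem (scalar_End M ` X)"

definition quot_Ann_in_End ::
    "('a, 'r) ring_scheme \<Rightarrow> ('a, 'b, 'm) module_scheme \<Rightarrow> ('b \<Rightarrow> 'b) set" where
  "quot_Ann_in_End R M = quot_Ann_embedding M ` carrier (R Quot module_Ann R M)"

definition finite_nbhd ::
    "('a, 'r) ring_scheme \<Rightarrow> ('a, 'b, 'm) module_scheme \<Rightarrow> 'b set \<Rightarrow> ('b \<Rightarrow> 'b) \<Rightarrow> ('b \<Rightarrow> 'b) set" where
  "finite_nbhd R M F f = {g \<in> carrier (module_End R M). \<forall>x\<in>F. g x = f x}"

definition finite_topology ::
    "('a, 'r) ring_scheme \<Rightarrow> ('a, 'b, 'm) module_scheme \<Rightarrow> ('b \<Rightarrow> 'b) topology" where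
  "finite_topology R M = topology_generated_by
     {finite_nbhd R M F f | F f. finite F \<and> F \<subseteq> carrier M \<and> f \<in> carrier (module_End R M)}"

lemma topspace_finite_topology: "topspace (finite_topology R M) = carrier (module_End R M)"
proof -
  have "f \<in> \<Union>{finite_nbhd R M F f | F f. finite F \<and> F \<subseteq> carrier M \<and> f \<in> carrier (module_End R M)}"
    if "f \<in> carrier (module_End R M)" for f
    using that by (intro UnionI[of "finite_nbhd R M {} f"]) (auto simp: finite_nbhd_def)
  then show ?thesis
    unfolding finite_topology_def topology_generated_by_topspace by (auto simp: finite_nbhd_def)
qed

lemma openin_finite_topology_iff:
  "openin (finite_topology R M) U \<longleftrightarrow> U \<subseteq> carrier (module_End R M) \<and>
     (\<forall>f\<in>U. \<exists>F. finite F \<and> F \<subseteq> carrier M \<and> finite_nbhd R M F f \<subseteq> U)" (is "_ \<longleftrightarrow> ?rhs")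
proof
  assume op: "openin (finite_topology R M) U"
  have "\<forall>f\<in>U. \<exists>F. finite F \<and> F \<subseteq> carrier M \<and> finite_nbhd R M F f \<subseteq> U"
    using op unfolding finite_topology_def openin_topology_generated_by_iff
  proof (induction rule: generate_topology_on.induct)
    case Empty
    then show ?case by simp
  next
    case (Int U V)
    show ?case
    proof
      fix f assume "f \<in> U \<inter> V"
      then have f: "f \<in> U" "f \<in> V" by simp_all
      obtain F where "finite F" "F \<subseteq> carrier M" "finite_nbhd R M F f \<subseteq> U"
        using bspec[OF Int.IH(1) f(1)] by (elim exE conjE)
      moreover obtain G where "finite G" "G \<subseteq> carrier M" "finite_nbhd R M G f \<subseteq> V"
        using bspec[OF Int.IH(2) f(2)] by (elim exE conjE)
      ultimately show "\<exists>F. finite F \<and> F \<subseteq> carrier M \<and> finite_nbhd R M F f \<subseteq> U \<inter> V"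
        by (intro exI[of _ "F \<union> G"]) (auto simp: finite_nbhd_def)
    qed
  next
    case (UN K)
    show ?case
    proof
      fix f assume "f \<in> \<Union>K"
      then obtain U where U: "U \<in> K" "f \<in> U" by (rule UnionE)
      obtain F where "finite F" "F \<subseteq> carrier M" "finite_nbhd R M F f \<subseteq> U"
        using bspec[OF UN.IH[OF U(1)] U(2)] by (elim exE conjE)
      moreover have "U \<subseteq> \<Union>K" using U(1) by (rule Union_upper)
      ultimately show "\<exists>F. finite F \<and> F \<subseteq> carrier M \<and> finite_nbhd R M F f \<subseteq> \<Union>K"
        by (meson order_trans)
    qed
  next
    case (Basis S)
    then obtain F g where "finite F" "F \<subseteq> carrier M" "S = finite_nbhd R M F g" by blast
    then show ?case by (intro ballI exI[of _ F]) (auto simp: finite_nbhd_def)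
  qed
  then show ?rhs using openin_subset[OF op] by (simp add: topspace_finite_topology)
next
  assume rhs: ?rhs
  have "\<exists>T. openin (finite_topology R M) T \<and> f \<in> T \<and> T \<subseteq> U" if f: "f \<in> U" for f
  proof -
    obtain F where F: "finite F" "F \<subseteq> carrier M" "finite_nbhd R M F f \<subseteq> U"
      using bspec[OF conjunct2[OF rhs] f] by (elim exE conjE)
    have End: "f \<in> carrier (module_End R M)" using conjunct1[OF rhs] f by (rule subsetD)
    have "openin (finite_topology R M) (finite_nbhd R M F f)"
      unfolding finite_topology_def
      by (rule topology_generated_by_Basis) (use F(1,2) End in blast)
    moreover have "f \<in> finite_nbhd R M F f" using End by (simp add: finite_nbhd_def)
    ultimately show ?thesis using F(3) by (intro exI conjI)
  qed
  then show "openin (finite_topology R M) U" by (subst openin_subopen) (intro ballI)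
qed

context Module.module
begin

lemma module_End_ring: "ring (module_End R M)"
proof (rule ringI)
  show "abelian_group (module_End R M)"
  proof (rule abelian_groupI)
    fix f assume f: "f \<in> carrier (module_End R M)"
    have mem: "f x \<in> carrier M" if "x \<in> carrier M" for x
      using f that by (auto simp: module_End_def)
    have "(\<lambda>x\<in>carrier M. \<ominus>\<^bsub>M\<^esub> f x) \<in> carrier (module_End R M)"
      using f mem by (auto simp: module_End_def M.minus_add smult_r_minus)
    moreover have "(\<lambda>x\<in>carrier M. \<ominus>\<^bsub>M\<^esub> f x) \<oplus>\<^bsub>module_End R M\<^esub> f = \<zero>\<^bsub>module_End R M\<^esub>"
      using mem by (auto simp: module_End_def M.l_neg fun_eq_iff)
    ultimately show "\<exists>g\<in>carrier (module_End R M).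
        g \<oplus>\<^bsub>module_End R M\<^esub> f = \<zero>\<^bsub>module_End R M\<^esub>" by blast
    show "\<zero>\<^bsub>module_End R M\<^esub> \<oplus>\<^bsub>module_End R M\<^esub> f = f"
      using f by (auto simp: module_End_def fun_eq_iff PiE_def Pi_def extensional_def)
  next
    fix f g assume fg: "f \<in> carrier (module_End R M)" "g \<in> carrier (module_End R M)"
    have mem: "f x \<in> carrier M" "g x \<in> carrier M" if "x \<in> carrier M" for x
      using fg that by (auto simp: module_End_def)
    show "f \<oplus>\<^bsub>module_End R M\<^esub> g \<in> carrier (module_End R M)"
      using fg mem by (auto simp: module_End_def M.a_ac smult_r_distr)
    show "f \<oplus>\<^bsub>module_End R M\<^esub> g = g \<oplus>\<^bsub>module_End R M\<^esub> f"
      using mem by (auto simp: module_End_def M.a_comm fun_eq_iff)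
  next
    fix f g h assume "f \<in> carrier (module_End R M)" "g \<in> carrier (module_End R M)"
      "h \<in> carrier (module_End R M)"
    then show "f \<oplus>\<^bsub>module_End R M\<^esub> g \<oplus>\<^bsub>module_End R M\<^esub> h =
        f \<oplus>\<^bsub>module_End R M\<^esub> (g \<oplus>\<^bsub>module_End R M\<^esub> h)"
      by (auto simp: module_End_def M.a_assoc fun_eq_iff PiE_def Pi_def)
  qed (auto simp: module_End_def)
  show "Group.monoid (module_End R M)"
    by (rule Group.monoidI)
      (auto simp: module_End_def compose_def fun_eq_iff PiE_def Pi_def extensional_def)
qed (auto simp: module_End_def compose_def fun_eq_iff PiE_def Pi_def)

lemma scalar_End_ring_hom: "scalar_End M \<in> ring_hom R (module_End R M)"
proof (rule ring_hom_memI)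
  fix a assume a: "a \<in> carrier R"
  have "b \<odot>\<^bsub>M\<^esub> (a \<odot>\<^bsub>M\<^esub> x) = a \<odot>\<^bsub>M\<^esub> (b \<odot>\<^bsub>M\<^esub> x)" if "b \<in> carrier R" "x \<in> carrier M" for b x
    using a that by (metis R.m_comm smult_assoc1)
  then show "scalar_End M a \<in> carrier (module_End R M)"
    using a by (auto simp: scalar_End_def module_End_def smult_r_distr)
qed (auto simp: scalar_End_def module_End_def compose_def fun_eq_iff smult_assoc1 smult_l_distr)

lemma module_Ann_eq_kernel: "module_Ann R M = a_kernel R (module_End R M) (scalar_End M)"
  by (auto simp: module_Ann_def a_kernel_def' scalar_End_def module_End_def fun_eq_iff
      restrict_def split: if_splits)

lemma scalar_End_ring_hom_ring: "ring_hom_ring R (module_End R M) (scalar_End M)"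
  by (rule ring_hom_ringI2[OF R.ring_axioms module_End_ring scalar_End_ring_hom])

lemma module_Ann_ideal: "ideal (module_Ann R M) R"
  unfolding module_Ann_eq_kernel by (rule ring_hom_ring.kernel_is_ideal[OF scalar_End_ring_hom_ring])

lemma quot_Ann_embedding_hom:
  "quot_Ann_embedding M \<in> ring_hom (R Quot module_Ann R M) (module_End R M)"
  using ring_hom_ring.the_elem_hom[OF scalar_End_ring_hom_ring]
  unfolding quot_Ann_embedding_def[abs_def] module_Ann_eq_kernel .

lemma quot_Ann_embedding_inj: "inj_on (quot_Ann_embedding M) (carrier (R Quot module_Ann R M))"
  using ring_hom_ring.the_elem_inj[OF scalar_End_ring_hom_ring]
  unfolding quot_Ann_embedding_def[abs_def] module_Ann_eq_kernel by (auto intro!: inj_onI)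

lemma quot_Ann_embedding_coset:
  assumes "a \<in> carrier R"
  shows "quot_Ann_embedding M (module_Ann R M +>\<^bsub>R\<^esub> a) = scalar_End M a"
  using ring_hom_ring.the_elem_simp[OF scalar_End_ring_hom_ring assms]
  unfolding quot_Ann_embedding_def module_Ann_eq_kernel .

end

end

theory Submission
  imports Defs
begin

text \<open>The link between the two conditions is that a projection \<open>e\<close> onto \<open>N\<close> lies in the closure of
  the scalars exactly when it acts on every finite subset of \<open>M\<close> as some scalar does.

  Such an \<open>e\<close> maps every submodule into itself. If \<open>y1 + y2\<close> lies in \<open>N\<close>, then
  \<open>y1 + y2 = e y1 + e y2\<close> decomposes it inside \<open>Y1 \<inter> N\<close> and \<open>Y2 \<inter> N\<close>, so \<open>N\<close> is distributive; the
  kernel of \<open>e\<close> is a complement.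

  Conversely let \<open>M = N \<oplus> N'\<close> with \<open>N\<close> distributive. A submodule \<open>Y\<close> containing \<open>n + n'\<close> contains \<open>n\<close>,
  because \<open>n \<in> (Y + N') \<inter> N = (Y \<inter> N) + (N' \<inter> N) = Y \<inter> N\<close>. For the cyclic \<open>Y\<close> generated by \<open>n + n'\<close>
  this gives a scalar \<open>a\<close> with \<open>a n = n\<close> and \<open>a n' = 0\<close>
  (\<open>distributive_complement_separating_scalar\<close>); in other words, the annihilators of \<open>n\<close> and \<open>n'\<close> are
  comaximal. As for comaximal ideals, the scalars belonging to different pairs are combined by
  \<open>a b\<close> and \<open>a + b - a b\<close> into one scalar that is good for finitely many vectors of \<open>N\<close> and of \<open>N'\<close>
  simultaneously (\<open>separating_scalar_finite\<close>), and this scalar agrees with the projection on any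
  prescribed finite set. Centrality comes from the topology alone: scalars commute with every
  endomorphism, and this passes to the closure (\<open>closure_scalars_commute\<close>).\<close>

context Module.module
begin

section \<open>Endomorphisms and the closure of the scalars\<close>

lemma module_End_closed: "f \<in> carrier (module_End R M) \<Longrightarrow> x \<in> carrier M \<Longrightarrow> f x \<in> carrier M"
  by (auto simp: module_End_def)

lemma module_End_add:
  "f \<in> carrier (module_End R M) \<Longrightarrow> x \<in> carrier M \<Longrightarrow> y \<in> carrier M \<Longrightarrow>
    f (x \<oplus>\<^bsub>M\<^esub> y) = f x \<oplus>\<^bsub>M\<^esub> f y"
  by (auto simp: module_End_def)

lemma module_End_smult:
  "f \<in> carrier (module_End R M) \<Longrightarrow> a \<in> carrier R \<Longrightarrow> x \<in> carrier M \<Longrightarrow>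
    f (a \<odot>\<^bsub>M\<^esub> x) = a \<odot>\<^bsub>M\<^esub> f x"
  by (auto simp: module_End_def)

lemma module_End_zero:
  assumes "f \<in> carrier (module_End R M)"
  shows "f \<zero>\<^bsub>M\<^esub> = \<zero>\<^bsub>M\<^esub>"
  using module_End_smult[OF assms R.zero_closed M.zero_closed] module_End_closed[OF assms M.zero_closed]
  by simp

lemma module_End_minus:
  assumes "f \<in> carrier (module_End R M)" "x \<in> carrier M"
  shows "f (\<ominus>\<^bsub>M\<^esub> x) = \<ominus>\<^bsub>M\<^esub> f x"
  using module_End_smult[OF assms(1) R.a_inv_closed[OF R.one_closed] assms(2)]
    module_End_closed[OF assms] assms(2)
  by (simp add: smult_l_minus)

lemma module_End_eqI:
  assumes "f \<in> carrier (module_End R M)" "g \<in> carrier (module_End R M)"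
    and "\<And>x. x \<in> carrier M \<Longrightarrow> f x = g x"
  shows "f = g"
  using assms by (intro extensionalityI[of f "carrier M" g]) (auto simp: module_End_def PiE_def)

lemma module_End_mult_apply: "x \<in> carrier M \<Longrightarrow> (f \<otimes>\<^bsub>module_End R M\<^esub> g) x = f (g x)"
  by (simp add: module_End_def compose_def)

lemma quot_Ann_in_End_eq_scalars: "quot_Ann_in_End R M = scalar_End M ` carrier R"
  by (auto simp: quot_Ann_in_End_def FactRing_def A_RCOSETS_def' quot_Ann_embedding_coset image_iff)

text \<open>Since the sets \<open>finite_nbhd R M F f\<close> form a neighbourhood base at \<open>f\<close>, being in the closure of the
  scalars means being interpolated by a scalar on every finite set.\<close>

lemma in_closure_scalars_iff:
  "f \<in> finite_topology R M closure_of quot_Ann_in_End R M \<longleftrightarrow>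
    f \<in> carrier (module_End R M) \<and>
    (\<forall>F. finite F \<longrightarrow> F \<subseteq> carrier M \<longrightarrow> (\<exists>a\<in>carrier R. \<forall>x\<in>F. f x = a \<odot>\<^bsub>M\<^esub> x))"
    (is "?L \<longleftrightarrow> ?R")
proof
  assume L: ?L
  then have f: "f \<in> carrier (module_End R M)"
    by (simp add: in_closure_of topspace_finite_topology)
  moreover have "\<exists>a\<in>carrier R. \<forall>x\<in>F. f x = a \<odot>\<^bsub>M\<^esub> x" if F: "finite F" "F \<subseteq> carrier M" for F
  proof -
    have "openin (finite_topology R M) (finite_nbhd R M F f)"
      using F f by (auto simp: finite_topology_def intro!: topology_generated_by_Basis)
    moreover have "f \<in> finite_nbhd R M F f"
      using f by (simp add: finite_nbhd_def)
    ultimately obtain g where "g \<in> quot_Ann_in_End R M" "g \<in> finite_nbhd R M F f"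
      using L unfolding in_closure_of by blast
    then obtain a where a: "a \<in> carrier R" "\<forall>x\<in>F. scalar_End M a x = f x"
      by (auto simp: quot_Ann_in_End_eq_scalars finite_nbhd_def)
    have "f x = a \<odot>\<^bsub>M\<^esub> x" if "x \<in> F" for x
      using a(2) that F(2) by (auto simp: scalar_End_def subset_iff)
    then show ?thesis
      using a(1) by blast
  qed
  ultimately show ?R by blast
next
  assume R: ?R
  have "\<exists>g. g \<in> quot_Ann_in_End R M \<and> g \<in> T"
    if T: "f \<in> T" "openin (finite_topology R M) T" for T
  proof -
    obtain F where F: "finite F" "F \<subseteq> carrier M" "finite_nbhd R M F f \<subseteq> T"
      using T unfolding openin_finite_topology_iff by blast
    then obtain a where a: "a \<in> carrier R" "\<forall>x\<in>F. f x = a \<odot>\<^bsub>M\<^esub> x"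
      using R by blast
    have "scalar_End M a \<in> finite_nbhd R M F f"
      using a F(2) ring_hom_closed[OF scalar_End_ring_hom a(1)]
      by (auto simp: finite_nbhd_def scalar_End_def subset_iff)
    then show ?thesis
      using a(1) F(3) by (auto simp: quot_Ann_in_End_eq_scalars)
  qed
  then show ?L
    using R by (auto simp: in_closure_of topspace_finite_topology)
qed

lemma closure_scalars_preserves_submodule:
  assumes f: "f \<in> finite_topology R M closure_of quot_Ann_in_End R M"
    and Y: "submodule Y R M" and y: "y \<in> Y"
  shows "f y \<in> Y"
proof -
  have "{y} \<subseteq> carrier M"
    using submoduleE(1)[OF Y] y by blast
  then obtain a where "a \<in> carrier R" "f y = a \<odot>\<^bsub>M\<^esub> y"
    using f unfolding in_closure_scalars_iff
    by (meson finite.emptyI finite.insertI insertI1)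
  then show ?thesis
    using submoduleE(4)[OF Y] y by simp
qed

text \<open>To compare \<open>f (g x)\<close> with \<open>g (f x)\<close> it suffices to replace \<open>f\<close> by one scalar that agrees with it on
  the two vectors \<open>x\<close> and \<open>g x\<close>.\<close>

lemma closure_scalars_commute:
  assumes f: "f \<in> finite_topology R M closure_of quot_Ann_in_End R M"
    and g: "g \<in> carrier (module_End R M)"
  shows "f \<otimes>\<^bsub>module_End R M\<^esub> g = g \<otimes>\<^bsub>module_End R M\<^esub> f"
proof -
  interpret E: ring "module_End R M"
    by (rule module_End_ring)
  have fE: "f \<in> carrier (module_End R M)"
    using f by (simp add: in_closure_scalars_iff)
  show ?thesis
  proof (rule module_End_eqI)
    fix x assume x: "x \<in> carrier M"
    have "{x, g x} \<subseteq> carrier M"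
      using x module_End_closed[OF g] by simp
    then obtain a where a: "a \<in> carrier R" "f x = a \<odot>\<^bsub>M\<^esub> x" "f (g x) = a \<odot>\<^bsub>M\<^esub> g x"
      using f unfolding in_closure_scalars_iff
      by (meson finite.emptyI finite.insertI insertI1 insertI2)
    show "(f \<otimes>\<^bsub>module_End R M\<^esub> g) x = (g \<otimes>\<^bsub>module_End R M\<^esub> f) x"
      using x a module_End_smult[OF g] by (simp add: module_End_mult_apply)
  qed (use fE g in auto)
qed

section \<open>Projections and direct summands\<close>

lemma mem_set_add_iff: "x \<in> H <+>\<^bsub>M\<^esub> K \<longleftrightarrow> (\<exists>h\<in>H. \<exists>k\<in>K. x = h \<oplus>\<^bsub>M\<^esub> k)"
  by (auto simp: set_add_def')

lemma set_addI: "h \<in> H \<Longrightarrow> k \<in> K \<Longrightarrow> h \<oplus>\<^bsub>M\<^esub> k \<in> H <+>\<^bsub>M\<^esub> K"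
  by (auto simp: mem_set_add_iff)

lemma submodule_zero: "submodule H R M \<Longrightarrow> \<zero>\<^bsub>M\<^esub> \<in> H"
  using subgroup.one_closed[OF submodule.axioms(1)] by fastforce

lemma module_End_kernel_submodule:
  assumes f: "f \<in> carrier (module_End R M)"
  shows "submodule {x \<in> carrier M. f x = \<zero>\<^bsub>M\<^esub>} R M"
  by (rule submoduleI)
    (auto simp: module_End_zero[OF f] module_End_minus[OF f] module_End_add[OF f]
      module_End_smult[OF f])

lemma idempotent_image_direct_summand:
  assumes e: "e \<in> carrier (module_End R M)" and idem: "\<And>x. x \<in> carrier M \<Longrightarrow> e (e x) = e x"
    and N: "submodule (e ` carrier M) R M"
  shows "direct_summand R M (e ` carrier M)"
proof -
  define K where "K = {x \<in> carrier M. e x = \<zero>\<^bsub>M\<^esub>}"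
  have K: "submodule K R M"
    unfolding K_def by (rule module_End_kernel_submodule[OF e])
  have "e ` carrier M \<inter> K = {\<zero>\<^bsub>M\<^esub>}"
    using submodule_zero[OF N] submodule_zero[OF K] idem by (auto simp: K_def)
  moreover have "x \<in> e ` carrier M <+>\<^bsub>M\<^esub> K" if x: "x \<in> carrier M" for x
  proof -
    have ex: "e x \<in> carrier M"
      using module_End_closed[OF e x] .
    have "e (x \<ominus>\<^bsub>M\<^esub> e x) = \<zero>\<^bsub>M\<^esub>"
      using x ex by (simp add: a_minus_def module_End_add[OF e] module_End_minus[OF e] idem M.r_neg)
    then have "x \<ominus>\<^bsub>M\<^esub> e x \<in> K"
      using x ex by (simp add: K_def)
    moreover have "x = e x \<oplus>\<^bsub>M\<^esub> (x \<ominus>\<^bsub>M\<^esub> e x)"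
      using x ex by (simp add: a_minus_def M.a_lcomm M.r_neg)
    ultimately show ?thesis
      using x unfolding mem_set_add_iff by blast
  qed
  moreover have "e ` carrier M <+>\<^bsub>M\<^esub> K \<subseteq> carrier M"
    by (rule M.set_add_closed[OF submoduleE(1)[OF N] submoduleE(1)[OF K]])
  ultimately show ?thesis
    using N K unfolding direct_summand_def by blast
qed

lemma direct_sum_projection:
  assumes N: "submodule N R M" and K: "submodule K R M"
    and int: "N \<inter> K = {\<zero>\<^bsub>M\<^esub>}" and sum: "N <+>\<^bsub>M\<^esub> K = carrier M"
  obtains e where "e \<in> carrier (module_End R M)"
    and "\<And>n k. n \<in> N \<Longrightarrow> k \<in> K \<Longrightarrow> e (n \<oplus>\<^bsub>M\<^esub> k) = n"
proof -
  note NM = subsetD[OF submoduleE(1)[OF N]] and KM = subsetD[OF submoduleE(1)[OF K]]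
  have uniq: "n = n'"
    if n: "n \<in> N" "n' \<in> N" and k: "k \<in> K" "k' \<in> K" and eq: "n \<oplus>\<^bsub>M\<^esub> k = n' \<oplus>\<^bsub>M\<^esub> k'" for n n' k k'
  proof -
    have c: "n \<in> carrier M" "n' \<in> carrier M" "k \<in> carrier M" "k' \<in> carrier M"
      using n k NM KM by auto
    have "n \<oplus>\<^bsub>M\<^esub> \<ominus>\<^bsub>M\<^esub> n' = (n \<oplus>\<^bsub>M\<^esub> k) \<oplus>\<^bsub>M\<^esub> (\<ominus>\<^bsub>M\<^esub> k \<oplus>\<^bsub>M\<^esub> \<ominus>\<^bsub>M\<^esub> n')"
      using c by (simp add: M.a_assoc M.r_neg2)
    also have "\<dots> = k' \<oplus>\<^bsub>M\<^esub> \<ominus>\<^bsub>M\<^esub> k"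
      unfolding eq using c by (simp add: M.a_ac M.r_neg1 M.r_neg M.r_neg2)
    finally have "n \<oplus>\<^bsub>M\<^esub> \<ominus>\<^bsub>M\<^esub> n' = k' \<oplus>\<^bsub>M\<^esub> \<ominus>\<^bsub>M\<^esub> k" .
    moreover have "n \<oplus>\<^bsub>M\<^esub> \<ominus>\<^bsub>M\<^esub> n' \<in> N" "k' \<oplus>\<^bsub>M\<^esub> \<ominus>\<^bsub>M\<^esub> k \<in> K"
      using n k submoduleE(3,5)[OF N] submoduleE(3,5)[OF K] by auto
    ultimately have "n \<oplus>\<^bsub>M\<^esub> \<ominus>\<^bsub>M\<^esub> n' \<in> N \<inter> K"
      by simp
    then have "n \<oplus>\<^bsub>M\<^esub> \<ominus>\<^bsub>M\<^esub> n' = \<zero>\<^bsub>M\<^esub>"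
      using int by simp
    then show ?thesis
      using M.minus_equality[of n "\<ominus>\<^bsub>M\<^esub> n'"] c by simp
  qed
  have "\<forall>x\<in>carrier M. \<exists>n. n \<in> N \<and> (\<exists>k\<in>K. x = n \<oplus>\<^bsub>M\<^esub> k)"
    using mem_set_add_iff[of _ N K] unfolding sum by blast
  then obtain p where p: "\<forall>x\<in>carrier M. p x \<in> N \<and> (\<exists>k\<in>K. x = p x \<oplus>\<^bsub>M\<^esub> k)"
    by metis
  define e where "e = restrict p (carrier M)"
  have eq: "e (n \<oplus>\<^bsub>M\<^esub> k) = n" if "n \<in> N" "k \<in> K" for n k
    using p uniq that NM KM unfolding e_def by (metis M.add.m_closed restrict_apply')
  have "e \<in> carrier (module_End R M)"
  proof -
    have "e (x \<oplus>\<^bsub>M\<^esub> y) = e x \<oplus>\<^bsub>M\<^esub> e y" if "x \<in> carrier M" "y \<in> carrier M" for x y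
    proof -
      obtain n k n' k' where d: "n \<in> N" "k \<in> K" "x = n \<oplus>\<^bsub>M\<^esub> k" "n' \<in> N" "k' \<in> K" "y = n' \<oplus>\<^bsub>M\<^esub> k'"
        using \<open>x \<in> carrier M\<close> \<open>y \<in> carrier M\<close> p by metis
      have "x \<oplus>\<^bsub>M\<^esub> y = (n \<oplus>\<^bsub>M\<^esub> n') \<oplus>\<^bsub>M\<^esub> (k \<oplus>\<^bsub>M\<^esub> k')"
        using d NM KM by (simp add: M.a_ac)
      then show ?thesis
        using d eq submoduleE(5)[OF N] submoduleE(5)[OF K] by simp
    qed
    moreover have "e (a \<odot>\<^bsub>M\<^esub> x) = a \<odot>\<^bsub>M\<^esub> e x" if "a \<in> carrier R" "x \<in> carrier M" for a x
    proof -
      obtain n k where d: "n \<in> N" "k \<in> K" "x = n \<oplus>\<^bsub>M\<^esub> k"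
        using \<open>x \<in> carrier M\<close> p by metis
      then show ?thesis
        using that eq submoduleE(4)[OF N] submoduleE(4)[OF K] NM KM by (simp add: smult_r_distr)
    qed
    ultimately show ?thesis
      using p NM by (auto simp: module_End_def e_def)
  qed
  then show ?thesis
    using that eq by blast
qed

section \<open>Separating a distributive summand from its complement by scalars\<close>

lemma cyclic_submodule:
  assumes x: "x \<in> carrier M"
  shows "submodule ((\<lambda>a. a \<odot>\<^bsub>M\<^esub> x) ` carrier R) R M"
proof (rule submoduleI)
  show "\<zero>\<^bsub>M\<^esub> \<in> (\<lambda>a. a \<odot>\<^bsub>M\<^esub> x) ` carrier R"
    using x by (intro image_eqI[of _ _ \<zero>]) auto
qed (use x in \<open>auto simp: smult_l_minus[symmetric] smult_l_distr[symmetric] smult_assoc1[symmetric]\<close>)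

text \<open>As the difference of \<open>n + k \<in> Y\<close> and \<open>k\<close>, the vector \<open>n\<close> lies in \<open>(Y + K) \<inter> N\<close>. Distributivity
  splits this intersection, and \<open>K \<inter> N\<close> contributes nothing.\<close>

lemma distributive_complement_component_mem:
  assumes N: "distributive_submodule R M N" and K: "submodule K R M" and int: "N \<inter> K = {\<zero>\<^bsub>M\<^esub>}"
    and Y: "submodule Y R M" and n: "n \<in> N" and k: "k \<in> K" and nk: "n \<oplus>\<^bsub>M\<^esub> k \<in> Y"
  shows "n \<in> Y"
proof -
  have c: "n \<in> carrier M" "k \<in> carrier M"
    using N n k submoduleE(1)[OF K] submoduleE(1)[of N]
    by (auto simp: distributive_submodule_def)
  have "n = (n \<oplus>\<^bsub>M\<^esub> k) \<oplus>\<^bsub>M\<^esub> \<ominus>\<^bsub>M\<^esub> k"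
    using c by (simp add: M.a_assoc M.r_neg)
  then have "n \<in> (Y <+>\<^bsub>M\<^esub> K) \<inter> N"
    using set_addI[OF nk submoduleE(3)[OF K k]] n by simp
  then have "n \<in> (Y \<inter> N) <+>\<^bsub>M\<^esub> (K \<inter> N)"
    using N Y K by (auto simp: distributive_submodule_def)
  then obtain y z where yz: "y \<in> Y" "z \<in> K \<inter> N" "n = y \<oplus>\<^bsub>M\<^esub> z"
    unfolding mem_set_add_iff by blast
  have "z = \<zero>\<^bsub>M\<^esub>"
    using yz(2) int by auto
  moreover have "y \<in> carrier M"
    using submoduleE(1)[OF Y] yz(1) by blast
  ultimately show ?thesis
    using yz by simp
qed

text \<open>The cyclic submodule generated by \<open>n + k\<close> contains \<open>n\<close>, so \<open>n = a (n + k)\<close> for some \<open>a\<close>; comparing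
  components in \<open>N\<close> and \<open>K\<close> gives the two equations.\<close>

lemma distributive_complement_separating_scalar:
  assumes N: "distributive_submodule R M N" and K: "submodule K R M" and int: "N \<inter> K = {\<zero>\<^bsub>M\<^esub>}"
    and n: "n \<in> N" and k: "k \<in> K"
  obtains a where "a \<in> carrier R" "a \<odot>\<^bsub>M\<^esub> n = n" "a \<odot>\<^bsub>M\<^esub> k = \<zero>\<^bsub>M\<^esub>"
proof -
  have N': "submodule N R M"
    using N by (simp add: distributive_submodule_def)
  have c: "n \<in> carrier M" "k \<in> carrier M"
    using n k submoduleE(1)[OF K] submoduleE(1)[OF N'] by auto
  have "n \<oplus>\<^bsub>M\<^esub> k \<in> (\<lambda>a. a \<odot>\<^bsub>M\<^esub> (n \<oplus>\<^bsub>M\<^esub> k)) ` carrier R"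
    using c by (intro image_eqI[of _ _ \<one>]) auto
  then have "n \<in> (\<lambda>a. a \<odot>\<^bsub>M\<^esub> (n \<oplus>\<^bsub>M\<^esub> k)) ` carrier R"
    using distributive_complement_component_mem[OF N K int cyclic_submodule n k] c by simp
  then obtain a where a: "a \<in> carrier R" and eq: "n = a \<odot>\<^bsub>M\<^esub> n \<oplus>\<^bsub>M\<^esub> a \<odot>\<^bsub>M\<^esub> k"
    using c by (auto simp: smult_r_distr)
  have ac: "a \<odot>\<^bsub>M\<^esub> n \<in> carrier M" "a \<odot>\<^bsub>M\<^esub> k \<in> carrier M"
    using a c by auto
  have "a \<odot>\<^bsub>M\<^esub> k = \<ominus>\<^bsub>M\<^esub> (a \<odot>\<^bsub>M\<^esub> n) \<oplus>\<^bsub>M\<^esub> n"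
    by (subst (2) eq) (use ac in \<open>simp add: M.r_neg1\<close>)
  moreover have "\<ominus>\<^bsub>M\<^esub> (a \<odot>\<^bsub>M\<^esub> n) \<oplus>\<^bsub>M\<^esub> n \<in> N" "a \<odot>\<^bsub>M\<^esub> k \<in> K"
    using a n k submoduleE(3,4,5)[OF N'] submoduleE(4)[OF K] by auto
  ultimately have "a \<odot>\<^bsub>M\<^esub> k \<in> N \<inter> K"
    by simp
  then have "a \<odot>\<^bsub>M\<^esub> k = \<zero>\<^bsub>M\<^esub>"
    using int by auto
  moreover from this have "a \<odot>\<^bsub>M\<^esub> n = n"
    using eq ac by simp
  ultimately show ?thesis
    using that a by blast
qed

text \<open>If \<open>a\<close> and \<open>b\<close> fix a vector, so does \<open>a b\<close>; if one of them kills a vector, so does \<open>a b\<close>. Hence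
  products extend the set of killed vectors. The same remark for \<open>1 - a\<close> and \<open>1 - b\<close> shows that
  \<open>a + b - a b\<close>, whose complementary scalar is \<open>(1 - a) (1 - b)\<close>, extends the set of fixed vectors.\<close>

lemma separating_scalar_finite:
  assumes S: "finite S" "S \<subseteq> carrier M" and T: "finite T" "T \<subseteq> carrier M"
    and sep: "\<And>s t. s \<in> S \<Longrightarrow> t \<in> T \<Longrightarrow> \<exists>a\<in>carrier R. a \<odot>\<^bsub>M\<^esub> s = s \<and> a \<odot>\<^bsub>M\<^esub> t = \<zero>\<^bsub>M\<^esub>"
  shows "\<exists>a\<in>carrier R. (\<forall>s\<in>S. a \<odot>\<^bsub>M\<^esub> s = s) \<and> (\<forall>t\<in>T. a \<odot>\<^bsub>M\<^esub> t = \<zero>\<^bsub>M\<^esub>)"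
proof -
  have single: "\<exists>a\<in>carrier R. a \<odot>\<^bsub>M\<^esub> s = s \<and> (\<forall>t\<in>T. a \<odot>\<^bsub>M\<^esub> t = \<zero>\<^bsub>M\<^esub>)" if s: "s \<in> S" for s
    using T sep[OF s]
  proof (induction T rule: finite_induct)
    case empty
    then show ?case
      using s S(2) by (intro bexI[of _ \<one>]) auto
  next
    case (insert t T)
    then obtain a where a: "a \<in> carrier R" "a \<odot>\<^bsub>M\<^esub> s = s" "\<forall>t\<in>T. a \<odot>\<^bsub>M\<^esub> t = \<zero>\<^bsub>M\<^esub>"
      by auto
    obtain b where b: "b \<in> carrier R" "b \<odot>\<^bsub>M\<^esub> s = s" "b \<odot>\<^bsub>M\<^esub> t = \<zero>\<^bsub>M\<^esub>"
      using insert.prems(2)[of t] by auto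
    have "(b \<otimes> a) \<odot>\<^bsub>M\<^esub> s = s"
      using a b s S(2) by (simp add: smult_assoc1 subset_iff)
    moreover have "(b \<otimes> a) \<odot>\<^bsub>M\<^esub> u = \<zero>\<^bsub>M\<^esub>" if "u \<in> T" for u
      using a b that insert.prems(1) by (simp add: smult_assoc1 subset_iff)
    moreover have "(b \<otimes> a) \<odot>\<^bsub>M\<^esub> t = \<zero>\<^bsub>M\<^esub>"
      using a b insert.prems(1) by (simp add: R.m_comm[of b a] smult_assoc1)
    ultimately show ?case
      using a(1) b(1) by (intro bexI[of _ "b \<otimes> a"]) auto
  qed
  show ?thesis
    using S single
  proof (induction S rule: finite_induct)
    case empty
    then show ?case
      using T(2) by (intro bexI[of _ \<zero>]) auto
  next
    case (insert s S)
    then obtain a where a: "a \<in> carrier R" "\<forall>s\<in>S. a \<odot>\<^bsub>M\<^esub> s = s" "\<forall>t\<in>T. a \<odot>\<^bsub>M\<^esub> t = \<zero>\<^bsub>M\<^esub>"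
      by auto
    obtain b where b: "b \<in> carrier R" "b \<odot>\<^bsub>M\<^esub> s = s" "\<forall>t\<in>T. b \<odot>\<^bsub>M\<^esub> t = \<zero>\<^bsub>M\<^esub>"
      using insert.prems(2)[of s] by auto
    define c where "c = a \<oplus> b \<oplus> \<ominus> (a \<otimes> b)"
    have act: "c \<odot>\<^bsub>M\<^esub> x = a \<odot>\<^bsub>M\<^esub> x \<oplus>\<^bsub>M\<^esub> b \<odot>\<^bsub>M\<^esub> x \<oplus>\<^bsub>M\<^esub> \<ominus>\<^bsub>M\<^esub> (a \<odot>\<^bsub>M\<^esub> (b \<odot>\<^bsub>M\<^esub> x))"
      if "x \<in> carrier M" for x
      using a b that by (simp add: c_def smult_l_distr smult_l_minus smult_assoc1)
    have "c \<odot>\<^bsub>M\<^esub> s = s"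
      using a b insert.prems(1) by (simp add: act M.a_ac M.r_neg M.r_neg1 M.r_neg2)
    moreover have "c \<odot>\<^bsub>M\<^esub> u = u" if u: "u \<in> S" for u
    proof -
      have uM: "u \<in> carrier M"
        using u insert.prems(1) by auto
      then have "a \<odot>\<^bsub>M\<^esub> (b \<odot>\<^bsub>M\<^esub> u) = b \<odot>\<^bsub>M\<^esub> u"
        using a b u by (metis R.m_comm smult_assoc1)
      then show ?thesis
        using a b u uM by (simp add: act M.a_assoc M.r_neg)
    qed
    moreover have "c \<odot>\<^bsub>M\<^esub> t = \<zero>\<^bsub>M\<^esub>" if "t \<in> T" for t
      using a b that T(2) by (auto simp: act subset_iff)
    ultimately show ?case
      using a(1) b(1) by (intro bexI[of _ c]) (auto simp: c_def)
  qed
qed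

section \<open>The two implications\<close>

lemma closure_idempotent_image_complemented_distributive:
  assumes e: "e \<in> finite_topology R M closure_of quot_Ann_in_End R M"
    and idem: "\<And>x. x \<in> carrier M \<Longrightarrow> e (e x) = e x"
    and N: "submodule (e ` carrier M) R M"
  shows "complemented_distributive_submodule R M (e ` carrier M)"
proof -
  let ?N = "e ` carrier M"
  have eE: "e \<in> carrier (module_End R M)"
    using e by (simp add: in_closure_scalars_iff)
  have "(Y1 <+>\<^bsub>M\<^esub> Y2) \<inter> ?N = (Y1 \<inter> ?N) <+>\<^bsub>M\<^esub> (Y2 \<inter> ?N)"
    if Y: "submodule Y1 R M" "submodule Y2 R M" for Y1 Y2
  proof
    show "(Y1 \<inter> ?N) <+>\<^bsub>M\<^esub> (Y2 \<inter> ?N) \<subseteq> (Y1 <+>\<^bsub>M\<^esub> Y2) \<inter> ?N"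
    proof
      fix x assume "x \<in> (Y1 \<inter> ?N) <+>\<^bsub>M\<^esub> (Y2 \<inter> ?N)"
      then obtain y1 y2 where "y1 \<in> Y1 \<inter> ?N" "y2 \<in> Y2 \<inter> ?N" "x = y1 \<oplus>\<^bsub>M\<^esub> y2"
        unfolding mem_set_add_iff by blast
      then show "x \<in> (Y1 <+>\<^bsub>M\<^esub> Y2) \<inter> ?N"
        using set_addI[of y1 Y1 y2 Y2] submoduleE(5)[OF N, of y1 y2] by simp
    qed
    show "(Y1 <+>\<^bsub>M\<^esub> Y2) \<inter> ?N \<subseteq> (Y1 \<inter> ?N) <+>\<^bsub>M\<^esub> (Y2 \<inter> ?N)"
    proof
      fix x assume x: "x \<in> (Y1 <+>\<^bsub>M\<^esub> Y2) \<inter> ?N"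
      then obtain y1 y2 where y: "y1 \<in> Y1" "y2 \<in> Y2" "x = y1 \<oplus>\<^bsub>M\<^esub> y2"
        unfolding Int_iff mem_set_add_iff by blast
      have yM: "y1 \<in> carrier M" "y2 \<in> carrier M"
        using y submoduleE(1)[OF Y(1)] submoduleE(1)[OF Y(2)] by auto
      have "e x = x"
        using x idem by auto
      then have "x = e y1 \<oplus>\<^bsub>M\<^esub> e y2"
        using y(3) yM module_End_add[OF eE] by simp
      moreover have "e y1 \<in> Y1 \<inter> ?N" "e y2 \<in> Y2 \<inter> ?N"
        using closure_scalars_preserves_submodule[OF e] Y y yM by auto
      ultimately show "x \<in> (Y1 \<inter> ?N) <+>\<^bsub>M\<^esub> (Y2 \<inter> ?N)"
        unfolding mem_set_add_iff by blast
    qed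
  qed
  then show ?thesis
    using N idempotent_image_direct_summand[OF eE idem N]
    by (simp add: complemented_distributive_submodule_def distributive_submodule_def)
qed

lemma complemented_distributive_projection_in_closure:
  assumes "complemented_distributive_submodule R M N"
  obtains e where "central_idempotent (module_End R M) e" "e ` carrier M = N"
    "e \<in> finite_topology R M closure_of quot_Ann_in_End R M"
proof -
  have N: "distributive_submodule R M N" and N': "submodule N R M"
    using assms
    by (auto simp: complemented_distributive_submodule_def distributive_submodule_def)
  obtain K where K: "submodule K R M" and int: "N \<inter> K = {\<zero>\<^bsub>M\<^esub>}" and sum: "N <+>\<^bsub>M\<^esub> K = carrier M"
    using assms by (auto simp: complemented_distributive_submodule_def direct_summand_def)
  obtain e where e: "e \<in> carrier (module_End R M)"
    and proj: "\<And>n k. n \<in> N \<Longrightarrow> k \<in> K \<Longrightarrow> e (n \<oplus>\<^bsub>M\<^esub> k) = n"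
    using direct_sum_projection[OF N' K int sum] by blast
  note NM = subsetD[OF submoduleE(1)[OF N']] and KM = subsetD[OF submoduleE(1)[OF K]]
  have decomp: "\<exists>n\<in>N. \<exists>k\<in>K. x = n \<oplus>\<^bsub>M\<^esub> k" if "x \<in> carrier M" for x
    using that mem_set_add_iff[of x N K] unfolding sum by blast
  have eN: "e x \<in> N" if "x \<in> carrier M" for x
    using decomp[OF that] proj by auto
  have fixed: "e n = n" if "n \<in> N" for n
    using proj[OF that submodule_zero[OF K]] NM[OF that] by simp
  have image: "e ` carrier M = N"
  proof
    show "N \<subseteq> e ` carrier M"
      using fixed NM by (metis image_eqI subsetI)
  qed (use eN in blast)
  have "\<exists>a\<in>carrier R. \<forall>x\<in>F. e x = a \<odot>\<^bsub>M\<^esub> x" if F: "finite F" "F \<subseteq> carrier M" for F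
  proof -
    have "\<exists>k. k \<in> K \<and> e x \<oplus>\<^bsub>M\<^esub> k = x" if "x \<in> carrier M" for x
      using decomp[OF that] proj by metis
    then obtain q where q: "\<And>x. x \<in> carrier M \<Longrightarrow> q x \<in> K"
      and split: "\<And>x. x \<in> carrier M \<Longrightarrow> e x \<oplus>\<^bsub>M\<^esub> q x = x"
      by metis
    have "\<exists>a\<in>carrier R. (\<forall>s\<in>e ` F. a \<odot>\<^bsub>M\<^esub> s = s) \<and> (\<forall>t\<in>q ` F. a \<odot>\<^bsub>M\<^esub> t = \<zero>\<^bsub>M\<^esub>)"
    proof (rule separating_scalar_finite)
      show "e ` F \<subseteq> carrier M" "q ` F \<subseteq> carrier M"
        using F(2) NM[OF eN] KM[OF q] by blast+
      show "\<exists>a\<in>carrier R. a \<odot>\<^bsub>M\<^esub> s = s \<and> a \<odot>\<^bsub>M\<^esub> t = \<zero>\<^bsub>M\<^esub>" if "s \<in> e ` F" "t \<in> q ` F" for s t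
      proof -
        have "s \<in> N" "t \<in> K"
          using that F(2) eN q by blast+
        then show ?thesis
          using distributive_complement_separating_scalar[OF N K int] by blast
      qed
    qed (use F in auto)
    then obtain a where a: "a \<in> carrier R" "\<And>x. x \<in> F \<Longrightarrow> a \<odot>\<^bsub>M\<^esub> e x = e x"
      "\<And>x. x \<in> F \<Longrightarrow> a \<odot>\<^bsub>M\<^esub> q x = \<zero>\<^bsub>M\<^esub>"
      by auto
    have "e x = a \<odot>\<^bsub>M\<^esub> x" if "x \<in> F" for x
    proof -
      have x: "x \<in> carrier M"
        using that F(2) by auto
      have "a \<odot>\<^bsub>M\<^esub> (e x \<oplus>\<^bsub>M\<^esub> q x) = e x"
        using a(1) a(2,3)[OF that] x NM[OF eN[OF x]] KM[OF q[OF x]]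
        by (simp add: smult_r_distr)
      then show ?thesis
        using split[OF x] by simp
    qed
    then show ?thesis
      using a(1) by blast
  qed
  then have cl: "e \<in> finite_topology R M closure_of quot_Ann_in_End R M"
    using e by (simp add: in_closure_scalars_iff)
  interpret E: ring "module_End R M"
    by (rule module_End_ring)
  have "e \<otimes>\<^bsub>module_End R M\<^esub> e = e"
    using e eN fixed by (intro module_End_eqI) (auto simp: module_End_mult_apply)
  then have "central_idempotent (module_End R M) e"
    using e closure_scalars_commute[OF cl] unfolding central_idempotent_def by blast
  then show ?thesis
    using that image cl by blast
qed

end

theorem proposition3p15:
  fixes A :: "('a, 'r) ring_scheme" and M :: "('a, 'b, 'm) module_scheme" and N :: "'b set"
  assumes "Module.module A M" and "submodule N A M"
  shows "complemented_distributive_submodule A M N \<longleftrightarrow>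
    (\<exists>e. central_idempotent (module_End A M) e \<and> e ` carrier M = N \<and>
         e \<in> finite_topology A M closure_of quot_Ann_in_End A M)"
proof -
  interpret Module.module A M
    by (rule assms(1))
  show ?thesis
  proof
    assume "complemented_distributive_submodule A M N"
    then show "\<exists>e. central_idempotent (module_End A M) e \<and> e ` carrier M = N \<and>
         e \<in> finite_topology A M closure_of quot_Ann_in_End A M"
      by (rule complemented_distributive_projection_in_closure) blast
  next
    assume "\<exists>e. central_idempotent (module_End A M) e \<and> e ` carrier M = N \<and>
         e \<in> finite_topology A M closure_of quot_Ann_in_End A M"
    then obtain e where e: "central_idempotent (module_End A M) e" and N: "e ` carrier M = N"
      and cl: "e \<in> finite_topology A M closure_of quot_Ann_in_End A M"
      by blast
    have "e \<otimes>\<^bsub>module_End A M\<^esub> e = e"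
      using e unfolding central_idempotent_def by blast
    then have "e (e x) = e x" if "x \<in> carrier M" for x
      using module_End_mult_apply[OF that, of e e] by simp
    then show "complemented_distributive_submodule A M N"
      using closure_idempotent_image_complemented_distributive[OF cl] assms(2) N by simp
  qed
qed

end
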